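(* Let $\Sigma$ be an implicational base over a finite set $U$ which is not premise-connected, and let $C$ be a premise-connected component of $\Sigma$. Then $\Sigma$ is H-decomposable if and only if both $\Sigma[C]$ (as a base over $C$) and $\Sigma[U\setminus C]$ (as a base over $U\setminus C$) are H-decomposable.
   Context: An implication over $U$ is written $A \to b$ with $A \subseteq U$ nonempty and $b \in U$; an implicational base over $U$ is a finite set of implications over $U$. For $X\subseteq U$, $\Sigma[X]=\{A\to b\in\Sigma : A\cup\{b\}\subseteq X\}$. A premise-path is a sequence $v_1,\dots,v_k$ of distinct elements of $U$ such that for each $1\le i<k$ some $A_i\to b_i\in\Sigma$ has $\{v_i,v_{i+1}\}\subseteq A_i$; $\Sigma$ is premise-connected if every two elements of $U$ are joined by a premise-path; a premise-connected component is an inclusion-maximal subset $C\subseteq U$ such that every two elements of $C$ are joined by a premise-path in $\Sigma$. A $\Sigma$-tree is a pair $(T,\lambda)$ where $T$ is a full rooted binary tree (every interior node has exactly two, unordered, children) and $\lambda$ labels the nodes so that: (1) each leaf is labelled by an element of $U$; (2) each interior node $t$ has $\lambda(t)\subseteq\Sigma$ (possibly empty); (3) for every interior node $t$ and every $A\to b\in\lambda(t)$, all elements of $A$ label leaves in the subtree of one child of $t$ and $b$ labels a leaf in the subtree of the other child; (4) each element of $U$ labels exactly one leaf and each implication of $\Sigma$ lies in the label of exactly one interior node. $\Sigma$ is H-decomposable if it has a $\Sigma$-tree; a base over the empty set is H-decomposable by convention. *)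

theory Defs
  imports Main
begin

text \<open>The pair \<open>(A, b)\<close> stands for the implication \<open>A \<rightarrow> b\<close>. The conclusion \<open>b\<close> is allowed to lie in \<open>A\<close>.\<close>

type_synonym 'a implication = "'a set \<times> 'a"

definition implicational_base :: "'a set \<Rightarrow> 'a implication set \<Rightarrow> bool" where
  "implicational_base U \<Sigma> \<longleftrightarrow>
     finite \<Sigma> \<and> (\<forall>(A, b) \<in> \<Sigma>. A \<noteq> {} \<and> A \<subseteq> U \<and> b \<in> U)"

definition restrict_base :: "'a implication set \<Rightarrow> 'a set \<Rightarrow> 'a implication set" where
  "restrict_base \<Sigma> X = {(A, b) \<in> \<Sigma>. A \<union> {b} \<subseteq> X}"

text \<open>A single vertex is a premise-path, so every element of \<open>U\<close> is joined to itself.\<close>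

definition premise_path :: "'a set \<Rightarrow> 'a implication set \<Rightarrow> 'a list \<Rightarrow> bool" where
  "premise_path U \<Sigma> vs \<longleftrightarrow>
     vs \<noteq> [] \<and> distinct vs \<and> set vs \<subseteq> U \<and>
     (\<forall>i. Suc i < length vs \<longrightarrow> (\<exists>(A, b) \<in> \<Sigma>. {vs ! i, vs ! Suc i} \<subseteq> A))"

definition premise_joined :: "'a set \<Rightarrow> 'a implication set \<Rightarrow> 'a \<Rightarrow> 'a \<Rightarrow> bool" where
  "premise_joined U \<Sigma> u v \<longleftrightarrow> (\<exists>vs. premise_path U \<Sigma> vs \<and> hd vs = u \<and> last vs = v)"

definition premise_connected :: "'a set \<Rightarrow> 'a implication set \<Rightarrow> bool" where
  "premise_connected U \<Sigma> \<longleftrightarrow> (\<forall>u\<in>U. \<forall>v\<in>U. premise_joined U \<Sigma> u v)"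

definition premise_component :: "'a set \<Rightarrow> 'a implication set \<Rightarrow> 'a set \<Rightarrow> bool" where
  "premise_component U \<Sigma> C \<longleftrightarrow>
     C \<subseteq> U \<and> (\<forall>u\<in>C. \<forall>v\<in>C. premise_joined U \<Sigma> u v) \<and>
     (\<forall>D. C \<subseteq> D \<and> D \<subseteq> U \<and> (\<forall>u\<in>D. \<forall>v\<in>D. premise_joined U \<Sigma> u v) \<longrightarrow> D = C)"

text \<open>
  Labelled full rooted binary trees. The datatype lists the two children in some order, but
  nothing below depends on that order: \<open>\<Sigma>\<close>-trees are closed under swapping children.
  The generated set functions \<open>leaf_labels\<close> and \<open>node_labels\<close> collect the labels of the leaves
  and of the interior nodes; multiplicities are counted separately.
\<close>

datatype (leaf_labels: 'a, node_labels: 'b) full_tree =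
    Leaf 'a
  | Node 'b "('a, 'b) full_tree" "('a, 'b) full_tree"

primrec subtrees :: "('a, 'b) full_tree \<Rightarrow> ('a, 'b) full_tree set" where
  "subtrees (Leaf u) = {Leaf u}"
| "subtrees (Node L l r) = insert (Node L l r) (subtrees l \<union> subtrees r)"

primrec count_leaves :: "('a \<Rightarrow> bool) \<Rightarrow> ('a, 'b) full_tree \<Rightarrow> nat" where
  "count_leaves P (Leaf u) = (if P u then 1 else 0)"
| "count_leaves P (Node L l r) = count_leaves P l + count_leaves P r"

primrec count_nodes :: "('b \<Rightarrow> bool) \<Rightarrow> ('a, 'b) full_tree \<Rightarrow> nat" where
  "count_nodes P (Leaf u) = 0"
| "count_nodes P (Node L l r) = (if P L then 1 else 0) + count_nodes P l + count_nodes P r"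

definition sigma_tree ::
    "'a set \<Rightarrow> 'a implication set \<Rightarrow> ('a, 'a implication set) full_tree \<Rightarrow> bool" where
  "sigma_tree U \<Sigma> T \<longleftrightarrow>
     leaf_labels T \<subseteq> U \<and>
     (\<forall>L \<in> node_labels T. L \<subseteq> \<Sigma>) \<and>
     (\<forall>L l r. Node L l r \<in> subtrees T \<longrightarrow>
        (\<forall>(A, b) \<in> L. (A \<subseteq> leaf_labels l \<and> b \<in> leaf_labels r) \<or>
                      (A \<subseteq> leaf_labels r \<and> b \<in> leaf_labels l))) \<and>
     (\<forall>u \<in> U. count_leaves (\<lambda>x. x = u) T = 1) \<and>
     (\<forall>i \<in> \<Sigma>. count_nodes (\<lambda>L. i \<in> L) T = 1)"

text \<open>
  Every tree has a leaf, so no \<open>\<Sigma>\<close>-tree exists over the empty set; bases over the empty set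
  are decomposable by convention.
\<close>

definition H_decomposable :: "'a set \<Rightarrow> 'a implication set \<Rightarrow> bool" where
  "H_decomposable U \<Sigma> \<longleftrightarrow> U = {} \<or> (\<exists>T. sigma_tree U \<Sigma> T)"

end

(* Restricting a tree to the leaves in X and contracting the nodes that lose a whole side gives a
   tree for the base restricted to X: such a node carries no implication over X, because an
   implication meets both sides of its node. This is the forward direction. Conversely, the premise
   of an implication lies inside C or inside its complement, so every implication over neither
   of the two sets crosses between them, and a new root carrying these implications joins the two
   given trees. *)

theory Submission
  imports Defs
begin

section \<open>Premise-connected components\<close>

lemma premise_joined_refl: "u \<in> U \<Longrightarrow> premise_joined U \<Sigma> u u"
  unfolding premise_joined_def premise_path_def by (rule exI[of _ "[u]"]) simp

lemma premise_joined_sym: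
  assumes "premise_joined U \<Sigma> u v"
  shows "premise_joined U \<Sigma> v u"
proof -
  obtain vs where vs: "premise_path U \<Sigma> vs" "hd vs = u" "last vs = v"
    using assms unfolding premise_joined_def by blast
  have "\<exists>(A, b)\<in>\<Sigma>. {rev vs ! i, rev vs ! Suc i} \<subseteq> A" if i: "Suc i < length (rev vs)" for i
  proof -
    \<comment> \<open>Reversal sends positions \<open>i\<close> and \<open>Suc i\<close> to
      \<open>Suc j\<close> and \<open>j\<close>; the condition on a consecutive pair ignores its
      order.\<close>
    define j where "j = length vs - Suc (Suc i)"
    have "rev vs ! i = vs ! Suc j" "rev vs ! Suc i = vs ! j" "Suc j < length vs"
      using i by (auto simp: j_def rev_nth Suc_diff_Suc)
    with vs(1) show ?thesis
      unfolding premise_path_def by (simp add: insert_commute)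
  qed
  with vs(1) have "premise_path U \<Sigma> (rev vs)"
    unfolding premise_path_def by simp
  with vs show ?thesis
    unfolding premise_joined_def premise_path_def by (metis hd_rev last_rev)
qed

text \<open>A path may not repeat vertices: if \<open>w\<close> already occurs, the path is cut at
  \<open>w\<close>; otherwise \<open>w\<close> is appended.\<close>

lemma premise_joined_step:
  assumes "premise_joined U \<Sigma> u v" and "(A, b) \<in> \<Sigma>" "v \<in> A" "w \<in> A" "w \<in> U"
  shows "premise_joined U \<Sigma> u w"
proof -
  obtain vs where vs: "premise_path U \<Sigma> vs" "hd vs = u" "last vs = v"
    using assms(1) unfolding premise_joined_def by blast
  show ?thesis
  proof (cases "w \<in> set vs")
    case True
    then obtain xs ys where split: "vs = (xs @ [w]) @ ys"
      by (metis append.assoc append_Cons append_Nil split_list)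
    have "\<exists>(A, b)\<in>\<Sigma>. {(xs @ [w]) ! i, (xs @ [w]) ! Suc i} \<subseteq> A"
      if i: "Suc i < length (xs @ [w])" for i
    proof -
      have "(xs @ [w]) ! i = vs ! i" "(xs @ [w]) ! Suc i = vs ! Suc i" "Suc i < length vs"
        using i by (auto simp: split nth_append nth_Cons')
      with vs(1) show ?thesis
        unfolding premise_path_def by simp
    qed
    with vs(1) have "premise_path U \<Sigma> (xs @ [w])"
      unfolding premise_path_def by (simp add: split)
    moreover have "hd (xs @ [w]) = u"
      using vs(2) by (cases xs) (auto simp: split)
    ultimately show ?thesis
      unfolding premise_joined_def by (metis last_snoc)
  next
    case False
    have ne: "vs \<noteq> []"
      using vs(1) unfolding premise_path_def by blast
    have "\<exists>(A, b)\<in>\<Sigma>. {(vs @ [w]) ! i, (vs @ [w]) ! Suc i} \<subseteq> A"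
      if i: "Suc i < length (vs @ [w])" for i
    proof (cases "Suc i < length vs")
      case True
      with vs(1) show ?thesis
        unfolding premise_path_def by (simp add: nth_append)
    next
      case False
      \<comment> \<open>The only new consecutive pair is \<open>v\<close>, \<open>w\<close>, and
        both lie in \<open>A\<close>.\<close>
      with i have "Suc i = length vs" by simp
      moreover from this have "vs ! i = v"
        using vs(3) ne by (metis diff_Suc_1 last_conv_nth)
      ultimately show ?thesis
        using assms(2-4) by (auto simp: nth_append)
    qed
    with vs(1) False assms(5) have "premise_path U \<Sigma> (vs @ [w])"
      unfolding premise_path_def by simp
    moreover have "hd (vs @ [w]) = u"
      using vs(2) ne by simp
    ultimately show ?thesis
      unfolding premise_joined_def by (metis last_snoc)
  qed
qed

text \<open>By reflexivity and symmetry, adding \<open>v\<close> to \<open>C\<close> keeps all pairs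
  joined, so maximality absorbs \<open>v\<close>.\<close>

lemma premise_component_maximal:
  assumes "premise_component U \<Sigma> C" "v \<in> U" "\<And>u. u \<in> C \<Longrightarrow> premise_joined U \<Sigma> u v"
  shows "v \<in> C"
proof -
  have "\<forall>x\<in>insert v C. \<forall>y\<in>insert v C. premise_joined U \<Sigma> x y"
    using assms unfolding premise_component_def
    by (auto intro: premise_joined_refl premise_joined_sym)
  with assms(1,2) have "insert v C = C"
    unfolding premise_component_def by (meson insert_subset subset_insertI)
  then show ?thesis by blast
qed

text \<open>If a premise meets \<open>C\<close> in \<open>v\<close>, each of its elements is one
  step beyond \<open>v\<close>, hence joined to all of \<open>C\<close> and absorbed by
  maximality.\<close>

lemma premise_component_closed:
  assumes "implicational_base U \<Sigma>" "premise_component U \<Sigma> C" "(A, b) \<in> \<Sigma>"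
  shows "A \<subseteq> C \<or> A \<subseteq> U - C"
proof -
  have AU: "A \<subseteq> U"
    using assms(1,3) unfolding implicational_base_def by auto
  have "w \<in> C" if v: "v \<in> A" "v \<in> C" and w: "w \<in> A" for v w
  proof (rule premise_component_maximal[OF assms(2)])
    show "w \<in> U" using w AU by blast
    show "premise_joined U \<Sigma> u w" if "u \<in> C" for u
      using premise_joined_step[OF _ assms(3) v(1) w \<open>w \<in> U\<close>] assms(2) that v(2)
      unfolding premise_component_def by blast
  qed
  with AU show ?thesis by blast
qed

text \<open>For \<open>C = {}\<close> the joinedness condition in
  \<open>premise_component_maximal\<close> is vacuous, which would put every element of
  \<open>U\<close> into \<open>C\<close>.\<close>

lemma premise_component_nonempty:
  "premise_component U \<Sigma> C \<Longrightarrow> U \<noteq> {} \<Longrightarrow> C \<noteq> {}"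
  using premise_component_maximal by fastforce

section \<open>Trees\<close>

primrec separates :: "('a, 'a implication set) full_tree \<Rightarrow> bool" where
  "separates (Leaf u) \<longleftrightarrow> True"
| "separates (Node L l r) \<longleftrightarrow>
     (\<forall>(A, b) \<in> L. (A \<subseteq> leaf_labels l \<and> b \<in> leaf_labels r) \<or>
                   (A \<subseteq> leaf_labels r \<and> b \<in> leaf_labels l)) \<and>
     separates l \<and> separates r"

text \<open>This ties the recursive predicate, suited to structural induction, to the subtree
  condition in \<open>sigma_tree\<close>.\<close>

lemma separates_iff:
  "separates T \<longleftrightarrow>
     (\<forall>L l r. Node L l r \<in> subtrees T \<longrightarrow>
        (\<forall>(A, b) \<in> L. (A \<subseteq> leaf_labels l \<and> b \<in> leaf_labels r) \<or>
                      (A \<subseteq> leaf_labels r \<and> b \<in> leaf_labels l)))"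
proof -
  \<comment> \<open>Keeping the node condition opaque leaves the induction to deal only with the
    quantifier over subtrees.\<close>
  define P :: "'a implication set \<Rightarrow> ('a, 'a implication set) full_tree \<Rightarrow>
      ('a, 'a implication set) full_tree \<Rightarrow> bool"
    where "P L l r \<longleftrightarrow>
      (\<forall>(A, b) \<in> L. (A \<subseteq> leaf_labels l \<and> b \<in> leaf_labels r) \<or>
                    (A \<subseteq> leaf_labels r \<and> b \<in> leaf_labels l))" for L l r
  have sepNode: "separates (Node L l r) \<longleftrightarrow> P L l r \<and> separates l \<and> separates r" for L l r
    unfolding P_def by simp
  have "separates T \<longleftrightarrow> (\<forall>L l r. Node L l r \<in> subtrees T \<longrightarrow> P L l r)"
  proof (induction T)
    case (Node L l r)
    then show ?case
      unfolding sepNode by auto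
  qed simp
  then show ?thesis unfolding P_def .
qed

lemma sigma_tree_iff:
  "sigma_tree U \<Sigma> T \<longleftrightarrow>
     leaf_labels T \<subseteq> U \<and> (\<forall>L \<in> node_labels T. L \<subseteq> \<Sigma>) \<and> separates T \<and>
     (\<forall>u \<in> U. count_leaves (\<lambda>x. x = u) T = 1) \<and>
     (\<forall>i \<in> \<Sigma>. count_nodes (\<lambda>L. i \<in> L) T = 1)"
  unfolding sigma_tree_def separates_iff ..

lemma count_leaves_eq_0: "u \<notin> leaf_labels T \<Longrightarrow> count_leaves (\<lambda>x. x = u) T = 0"
  by (induction T) auto

lemma count_nodes_eq_0: "\<forall>L \<in> node_labels T. i \<notin> L \<Longrightarrow> count_nodes (\<lambda>L. i \<in> L) T = 0"
  by (induction T) auto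

text \<open>The node carrying the implication has its premise below one child and its conclusion
  below the other. Contrapositively, a subtree missing one of these leaves has count 0.\<close>

lemma separates_count_nodes:
  "separates T \<Longrightarrow> count_nodes (\<lambda>L. (A, b) \<in> L) T \<noteq> 0 \<Longrightarrow> insert b A \<subseteq> leaf_labels T"
  by (induction T) (auto split: if_splits)

lemma sigma_tree_leaf_labels:
  assumes "sigma_tree U \<Sigma> T"
  shows "leaf_labels T = U"
proof
  show "leaf_labels T \<subseteq> U"
    using assms unfolding sigma_tree_def by blast
  show "U \<subseteq> leaf_labels T"
  proof
    fix u assume "u \<in> U"
    with assms have "count_leaves (\<lambda>x. x = u) T = 1"
      unfolding sigma_tree_def by blast
    then show "u \<in> leaf_labels T"
      using count_leaves_eq_0[of u T] by fastforce
  qed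
qed

section \<open>Pruning a tree to a subset of its leaves\<close>

primrec prune ::
    "'a set \<Rightarrow> ('a, 'a implication set) full_tree \<Rightarrow> ('a, 'a implication set) full_tree option"
where
  "prune X (Leaf u) = (if u \<in> X then Some (Leaf u) else None)"
| "prune X (Node L l r) =
     (case prune X l of
        None \<Rightarrow> prune X r
      | Some l' \<Rightarrow>
          (case prune X r of
             None \<Rightarrow> Some l'
           | Some r' \<Rightarrow> Some (Node (restrict_base L X) l' r')))"

text \<open>\<open>None\<close> plays the role of the empty tree, which is not a value of the
  datatype.\<close>

lemma prune_None: "prune X T = None \<longleftrightarrow> leaf_labels T \<inter> X = {}"
  by (induction T) (auto split: option.splits)

lemma prune_leaf_labels: "prune X T = Some T' \<Longrightarrow> leaf_labels T' = leaf_labels T \<inter> X"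
proof (induction T arbitrary: T')
  case (Leaf u)
  then show ?case by (auto split: if_splits)
next
  case (Node L l r)
  then show ?case
    using prune_None[of X l] prune_None[of X r] by (auto split: option.splits)
qed

lemma prune_node_labels:
  "prune X T = Some T' \<Longrightarrow> \<forall>L \<in> node_labels T. L \<subseteq> \<Sigma> \<Longrightarrow>
     \<forall>L \<in> node_labels T'. L \<subseteq> restrict_base \<Sigma> X"
  by (induction T arbitrary: T')
    (auto simp: restrict_base_def split: option.splits if_splits, blast+)

lemma prune_count_leaves:
  assumes "u \<in> X"
  shows "prune X T = Some T' \<Longrightarrow>
    count_leaves (\<lambda>x. x = u) T' = count_leaves (\<lambda>x. x = u) T"
proof (induction T arbitrary: T')
  case (Leaf v)
  then show ?case by (auto split: if_splits)
next
  case (Node L l r)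
  \<comment> \<open>A discarded child has no leaf in \<open>X\<close>, so it contributes nothing to
    the count of \<open>u\<close>.\<close>
  have "count_leaves (\<lambda>x. x = u) t = 0" if "prune X t = None" for t
    using that assms count_leaves_eq_0[of u t] prune_None[of X t] by blast
  with Node show ?case by (auto split: option.splits)
qed

text \<open>Children lose only leaves outside \<open>X\<close>, while the implications kept in a
  label lie inside \<open>X\<close>, so each stays split between the same two sides.\<close>

lemma prune_separates: "prune X T = Some T' \<Longrightarrow> separates T \<Longrightarrow> separates T'"
proof (induction T arbitrary: T')
  case (Leaf u)
  then show ?case by (auto split: if_splits)
next
  case (Node L l r)
  then show ?case
    by (fastforce simp: prune_leaf_labels restrict_base_def split: option.splits)
qed

text \<open>Contraction discards whole labels and subtrees; the point is that no occurrence of an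
  implication over \<open>X\<close> goes with them.\<close>

lemma prune_count_nodes:
  assumes "A \<subseteq> X" "b \<in> X" "A \<noteq> {}"
  shows "prune X T = Some T' \<Longrightarrow> separates T \<Longrightarrow>
    count_nodes (\<lambda>L. (A, b) \<in> L) T' = count_nodes (\<lambda>L. (A, b) \<in> L) T"
proof (induction T arbitrary: T')
  case (Leaf v)
  then show ?case by (auto split: if_splits)
next
  case (Node L l r)
  \<comment> \<open>A subtree without leaves in \<open>X\<close> misses \<open>b\<close>.\<close>
  have zero: "count_nodes (\<lambda>L. (A, b) \<in> L) t = 0" if "prune X t = None" "separates t" for t
    using that assms separates_count_nodes[of t A b] prune_None[of X t] by blast
  \<comment> \<open>If the label contained the implication, one side would hold \<open>b\<close> and
    the other an element of the nonempty \<open>A\<close>, both in \<open>X\<close>, so neither side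
    would be pruned away.\<close>
  have sides: "(A, b) \<notin> L" if "prune X l = None \<or> prune X r = None"
    using that assms Node.prems(2) prune_None[of X l] prune_None[of X r] by fastforce
  have "(A, b) \<in> restrict_base L X \<longleftrightarrow> (A, b) \<in> L"
    using assms unfolding restrict_base_def by auto
  with Node zero sides show ?case
    by (auto split: option.splits)
qed

lemma sigma_tree_prune:
  assumes "implicational_base U \<Sigma>" "sigma_tree U \<Sigma> T" "X \<subseteq> U" "prune X T = Some T'"
  shows "sigma_tree X (restrict_base \<Sigma> X) T'"
proof -
  have T: "\<forall>L \<in> node_labels T. L \<subseteq> \<Sigma>" "separates T"
      "\<forall>u \<in> U. count_leaves (\<lambda>x. x = u) T = 1"
      "\<forall>i \<in> \<Sigma>. count_nodes (\<lambda>L. i \<in> L) T = 1"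
    using assms(2) unfolding sigma_tree_iff by blast+
  have "leaf_labels T' \<subseteq> X"
    using prune_leaf_labels[OF assms(4)] by blast
  moreover have "count_leaves (\<lambda>x. x = u) T' = 1" if "u \<in> X" for u
    using that T(3) assms(3) prune_count_leaves[OF that assms(4)] by auto
  moreover have "count_nodes (\<lambda>L. i \<in> L) T' = 1" if "i \<in> restrict_base \<Sigma> X" for i
  proof -
    obtain A b where i: "i = (A, b)" by (cases i)
    with that assms(1) have "(A, b) \<in> \<Sigma>" "A \<subseteq> X" "b \<in> X" "A \<noteq> {}"
      unfolding restrict_base_def implicational_base_def by auto
    then have "count_nodes (\<lambda>L. (A, b) \<in> L) T' = count_nodes (\<lambda>L. (A, b) \<in> L) T"
      using prune_count_nodes assms(4) T(2) by metis
    with T(4) \<open>(A, b) \<in> \<Sigma>\<close> i show ?thesis by simp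
  qed
  ultimately show ?thesis
    unfolding sigma_tree_iff
    using prune_node_labels[OF assms(4) T(1)] prune_separates[OF assms(4) T(2)]
    by blast
qed

text \<open>The empty \<open>X\<close> is covered by the convention; a nonempty \<open>X\<close>
  meets the leaves, so pruning yields a tree.\<close>

lemma H_decomposable_restrict:
  assumes "implicational_base U \<Sigma>" "H_decomposable U \<Sigma>" "X \<subseteq> U"
  shows "H_decomposable X (restrict_base \<Sigma> X)"
proof (cases "X = {}")
  case False
  with assms obtain T where T: "sigma_tree U \<Sigma> T"
    unfolding H_decomposable_def by blast
  with False assms(3) have "prune X T \<noteq> None"
    by (auto simp: prune_None sigma_tree_leaf_labels)
  with sigma_tree_prune[OF assms(1) T assms(3)] show ?thesis
    unfolding H_decomposable_def by blast
qed (simp add: H_decomposable_def)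

section \<open>Joining two trees under a new root\<close>

lemma sigma_tree_join:
  assumes base: "implicational_base U \<Sigma>" and CU: "C \<subseteq> U"
    and closed: "\<And>A b. (A, b) \<in> \<Sigma> \<Longrightarrow> A \<subseteq> C \<or> A \<subseteq> U - C"
    and l: "sigma_tree C (restrict_base \<Sigma> C) l"
    and r: "sigma_tree (U - C) (restrict_base \<Sigma> (U - C)) r"
  shows "sigma_tree U \<Sigma>
    (Node (\<Sigma> - restrict_base \<Sigma> C - restrict_base \<Sigma> (U - C)) l r)"
    (is "sigma_tree U \<Sigma> (Node ?L l r)")
proof -
  note labels = sigma_tree_leaf_labels[OF l] sigma_tree_leaf_labels[OF r]
  have sub: "restrict_base \<Sigma> X \<subseteq> \<Sigma>" for X
    unfolding restrict_base_def by auto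
  have disj: "restrict_base \<Sigma> C \<inter> restrict_base \<Sigma> (U - C) = {}"
    unfolding restrict_base_def by auto
  have nodes: "\<forall>L \<in> node_labels l. L \<subseteq> restrict_base \<Sigma> C"
      "\<forall>L \<in> node_labels r. L \<subseteq> restrict_base \<Sigma> (U - C)"
    using l r unfolding sigma_tree_iff by simp_all
  have sep: "separates l" "separates r"
    using l r unfolding sigma_tree_iff by simp_all
  have "\<forall>L \<in> node_labels (Node ?L l r). L \<subseteq> \<Sigma>"
    using nodes sub by fastforce
  moreover have "separates (Node ?L l r)"
  proof -
    \<comment> \<open>The premise lies on one side by \<open>closed\<close>; the conclusion must lie
      on the other, since the implication belongs to neither restriction.\<close>
    have "(A \<subseteq> C \<and> b \<in> U - C) \<or> (A \<subseteq> U - C \<and> b \<in> C)" if "(A, b) \<in> ?L" for A b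
    proof -
      have "b \<in> U"
        using that base unfolding implicational_base_def by auto
      with that closed[of A b] show ?thesis
        unfolding restrict_base_def by auto
    qed
    with sep labels show ?thesis by auto
  qed
  moreover have "count_leaves (\<lambda>x. x = u) (Node ?L l r) = 1" if "u \<in> U" for u
  proof (cases "u \<in> C")
    case True
    with l labels count_leaves_eq_0[of u r] show ?thesis
      unfolding sigma_tree_def by simp
  next
    case False
    with that r labels count_leaves_eq_0[of u l] show ?thesis
      unfolding sigma_tree_def by simp
  qed
  moreover have "count_nodes (\<lambda>L. i \<in> L) (Node ?L l r) = 1" if "i \<in> \<Sigma>" for i
  proof -
    \<comment> \<open>The two restrictions and the root label partition \<open>\<Sigma>\<close>, so
      exactly one of the three counts is 1.\<close>
    have "count_nodes (\<lambda>L. i \<in> L) l = (if i \<in> restrict_base \<Sigma> C then 1 else 0)"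
      using l nodes(1) count_nodes_eq_0[of l i] unfolding sigma_tree_def by auto
    moreover have "count_nodes (\<lambda>L. i \<in> L) r = (if i \<in> restrict_base \<Sigma> (U - C) then 1 else 0)"
      using r nodes(2) count_nodes_eq_0[of r i] unfolding sigma_tree_def by auto
    ultimately show ?thesis
      using that disj by auto
  qed
  moreover have "leaf_labels (Node ?L l r) \<subseteq> U"
    using labels CU by auto
  ultimately show ?thesis
    unfolding sigma_tree_iff by blast
qed

theorem theorem1:
  fixes U C :: "'a set" and \<Sigma> :: "'a implication set"
  assumes "finite U"
    and "implicational_base U \<Sigma>"
    and "\<not> premise_connected U \<Sigma>"
    and "premise_component U \<Sigma> C"
  shows "H_decomposable U \<Sigma> \<longleftrightarrow>
    H_decomposable C (restrict_base \<Sigma> C) \<and>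
    H_decomposable (U - C) (restrict_base \<Sigma> (U - C))"
proof -
  have CU: "C \<subseteq> U"
    using assms(4) unfolding premise_component_def by blast
  have "U \<noteq> {}"
    using assms(3) unfolding premise_connected_def by blast
  then have C: "C \<noteq> {}"
    using premise_component_nonempty[OF assms(4)] by blast
  \<comment> \<open>All pairs in \<open>C\<close> are joined, so \<open>C = U\<close> would make the
    base premise-connected.\<close>
  have "C \<noteq> U"
    using assms(3,4) unfolding premise_connected_def premise_component_def by blast
  with CU have D: "U - C \<noteq> {}" by blast
  show ?thesis
  proof
    assume "H_decomposable U \<Sigma>"
    then show "H_decomposable C (restrict_base \<Sigma> C) \<and>
        H_decomposable (U - C) (restrict_base \<Sigma> (U - C))"
      using H_decomposable_restrict[OF assms(2)] CU by blast
  next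
    assume "H_decomposable C (restrict_base \<Sigma> C) \<and>
        H_decomposable (U - C) (restrict_base \<Sigma> (U - C))"
    \<comment> \<open>As both parts are nonempty, decomposability gives actual trees and not just
      the convention for the empty set.\<close>
    then obtain l r where
      "sigma_tree C (restrict_base \<Sigma> C) l"
      "sigma_tree (U - C) (restrict_base \<Sigma> (U - C)) r"
      using C D unfolding H_decomposable_def by blast
    with sigma_tree_join[OF assms(2) CU] premise_component_closed[OF assms(2,4)]
    show "H_decomposable U \<Sigma>"
      unfolding H_decomposable_def by blast
  qed
qed

end
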